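(* Let $M$ be an abelian group and let $G,H$ be graphs such that $G\prec_M H$ and $H\not\preccurlyeq_M\overrightarrow{K}_2$. Then there is a graph $K$ with $G\prec_M K\prec_M H$. If in addition $G\prec_h H$, then there is a graph $K$ satisfying both $G\prec_M K\prec_M H$ and $G\prec_h K\prec_h H$.
   Context: Graphs are finite directed graphs. For a circuit $C$ of the underlying undirected graph, $C^+$ and $C^-$ denote the sets of its edges oriented in each of the two directions around $C$. An $M$-tension on $G$ is a function $\tau:E(G)\to M$ such that $\sum_{e\in C^+}\tau(e)=\sum_{e\in C^-}\tau(e)$ for every circuit $C$ of $G$. A mapping $f:E(G)\to E(H)$ is $M$-tension-continuous if for every $M$-tension $\tau$ on $H$ the composition $\tau\circ f$ is an $M$-tension on $G$. Write $G\preccurlyeq_M H$ if there is an $M$-tension-continuous mapping $E(G)\to E(H)$, and $G\preccurlyeq_h H$ if there is a homomorphism of directed graphs $G\to H$ (a vertex map sending each edge $uv$ to an edge $h(u)h(v)$). For either quasiorder, $G\prec H$ means $G\preccurlyeq H$ and not $H\preccurlyeq G$. $\overrightarrow{K}_2$ is the directed graph with two vertices and a single directed edge. *)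

theory Defs
  imports "Graph_Theory.Arc_Walk" "HOL-Library.FuncSet"
begin

text \<open>
  Finite directed graphs are those satisfying \<^locale>\<open>fin_digraph\<close>: loops, parallel and
  antiparallel arcs are allowed, and so is the null graph.
\<close>

text \<open>
  The underlying undirected graph, as a digraph in which every arc can be traversed both ways:
  \<open>(e, True)\<close> traverses \<open>e\<close> along its orientation, \<open>(e, False)\<close> against it.
\<close>

definition both_ways :: "('v, 'e) pre_digraph \<Rightarrow> ('v, 'e \<times> bool) pre_digraph" where
  "both_ways G =
    \<lparr>verts = verts G,
     arcs = arcs G \<times> UNIV,
     tail = (\<lambda>(e, d). if d then tail G e else head G e),
     head = (\<lambda>(e, d). if d then head G e else tail G e)\<rparr>"

text \<open>
  A circuit together with a direction of traversal. Distinctness of the underlying arcs excludes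
  going along an arc and immediately back, which \<^const>\<open>pre_digraph.cycle\<close> would permit.
  A loop is a circuit of length one, two parallel or antiparallel arcs form one of length two.
\<close>

definition circuit :: "('v, 'e) pre_digraph \<Rightarrow> ('e \<times> bool) list \<Rightarrow> bool" where
  "circuit G C \<longleftrightarrow> pre_digraph.cycle (both_ways G) C \<and> distinct (map fst C)"

definition circuit_plus :: "('e \<times> bool) list \<Rightarrow> 'e set" where
  "circuit_plus C = {e. (e, True) \<in> set C}"

definition circuit_minus :: "('e \<times> bool) list \<Rightarrow> 'e set" where
  "circuit_minus C = {e. (e, False) \<in> set C}"

text \<open>
  The group \<open>M\<close> is a type of class \<^class>\<open>ab_group_add\<close>. Tensions and maps between arc sets are
  total functions whose values outside the arc set are irrelevant.
\<close>

definition tension :: "('v, 'e) pre_digraph \<Rightarrow> ('e \<Rightarrow> 'm::ab_group_add) \<Rightarrow> bool" where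
  "tension G t \<longleftrightarrow>
    (\<forall>C. circuit G C \<longrightarrow> (\<Sum>e\<in>circuit_plus C. t e) = (\<Sum>e\<in>circuit_minus C. t e))"

definition tension_continuous ::
  "'m::ab_group_add itself \<Rightarrow> ('v, 'e) pre_digraph \<Rightarrow> ('w, 'f) pre_digraph \<Rightarrow> ('e \<Rightarrow> 'f) \<Rightarrow> bool"
  where
  "tension_continuous M G H f \<longleftrightarrow>
    f \<in> arcs G \<rightarrow> arcs H \<and> (\<forall>t :: 'f \<Rightarrow> 'm. tension H t \<longrightarrow> tension G (t \<circ> f))"

definition tension_le ::
  "'m::ab_group_add itself \<Rightarrow> ('v, 'e) pre_digraph \<Rightarrow> ('w, 'f) pre_digraph \<Rightarrow> bool" where
  "tension_le M G H \<longleftrightarrow> (\<exists>f. tension_continuous M G H f)"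

definition tension_less ::
  "'m::ab_group_add itself \<Rightarrow> ('v, 'e) pre_digraph \<Rightarrow> ('w, 'f) pre_digraph \<Rightarrow> bool" where
  "tension_less M G H \<longleftrightarrow> tension_le M G H \<and> \<not> tension_le M H G"

definition digraph_hom ::
  "('v, 'e) pre_digraph \<Rightarrow> ('w, 'f) pre_digraph \<Rightarrow> ('v \<Rightarrow> 'w) \<Rightarrow> bool" where
  "digraph_hom G H h \<longleftrightarrow>
    h \<in> verts G \<rightarrow> verts H \<and> (\<forall>(u, v) \<in> arcs_ends G. (h u, h v) \<in> arcs_ends H)"

definition hom_le :: "('v, 'e) pre_digraph \<Rightarrow> ('w, 'f) pre_digraph \<Rightarrow> bool" where
  "hom_le G H \<longleftrightarrow> (\<exists>h. digraph_hom G H h)"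

definition hom_less :: "('v, 'e) pre_digraph \<Rightarrow> ('w, 'f) pre_digraph \<Rightarrow> bool" where
  "hom_less G H \<longleftrightarrow> hom_le G H \<and> \<not> hom_le H G"

definition K2 :: "(bool, unit) pre_digraph" where
  "K2 = \<lparr>verts = UNIV, arcs = UNIV, tail = (\<lambda>_. False), head = (\<lambda>_. True)\<rparr>"

end

theory Submission
  imports Defs
begin

text \<open>
  Take \<open>K = G + H'\<close>, where \<open>H'\<close> is a blow-up of \<open>H\<close> of large girth. An image of \<open>H\<close> meets
  \<open>H'\<close> in a forest, which can be sent to a single arc, so \<open>H \<preceq> K\<close> would give
  \<open>H \<preceq> G\<close> (or \<open>H \<preceq> K\<^sub>2\<close> when \<open>G\<close> has no arcs). Conversely \<open>H'\<close> is so rich in arcs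
  that \<open>H' \<preceq> G\<close> gives \<open>H \<preceq> G\<close>: a tension-continuous map \<open>f\<close> has a potential on the vertices
  of \<open>H'\<close> with values in \<open>\<int>\<^bsup>arcs G\<^esup>\<close> modulo the vectors \<open>L\<close> annihilated by all tensions;
  reduced modulo an integer \<open>N\<close> it becomes a finite vertex colouring, and arcs between the majority
  colour classes carry \<open>f\<close> back to \<open>H\<close>. Homomorphisms are tension-continuous, so the same \<open>K\<close>
  serves the second claim.
\<close>

section \<open>Tensions and potentials\<close>

text \<open>Counts with multiplicity and so makes sense on walks that repeat arcs; the sums over
  \<open>circuit_plus\<close> and \<open>circuit_minus\<close> run over sets.\<close>

definition wsum :: "('e \<Rightarrow> 'm::ab_group_add) \<Rightarrow> ('e \<times> bool) list \<Rightarrow> 'm" where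
  "wsum t p = (\<Sum>(e, d)\<leftarrow>p. if d then t e else - t e)"

lemma wsum_simps [simp]:
  "wsum t [] = 0"
  "wsum t ((e, d) # p) = (if d then t e else - t e) + wsum t p"
  "wsum t (p @ q) = wsum t p + wsum t q"
  by (simp_all add: wsum_def)

lemma wsum_cong: "(\<And>e. e \<in> fst ` set p \<Longrightarrow> s e = t e) \<Longrightarrow> wsum s p = wsum t p"
  by (induction p) auto

lemma both_ways_simps [simp]:
  "verts (both_ways G) = verts G"
  "arcs (both_ways G) = arcs G \<times> UNIV"
  "tail (both_ways G) (e, d) = (if d then tail G e else head G e)"
  "head (both_ways G) (e, d) = (if d then head G e else tail G e)"
  by (simp_all add: both_ways_def)

abbreviation bcas where "bcas G \<equiv> pre_digraph.cas (both_ways G)"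

lemmas bcas_simps [simp] = pre_digraph.cas.simps[where G = "both_ways G" for G]

lemma bcas_append: "bcas G u (p @ q) v \<longleftrightarrow> (\<exists>w. bcas G u p w \<and> bcas G w q v)"
  by (induction p arbitrary: u) auto

lemma wsum_potential:
  "bcas G u p v \<Longrightarrow> wsum (\<lambda>e. q (head G e) - q (tail G e)) p = q v - q u"
  by (induction p arbitrary: u) auto

lemma wsum_eq_circuit_sums:
  assumes "distinct (map fst p)"
  shows "wsum t p = (\<Sum>e\<in>circuit_plus p. t e) - (\<Sum>e\<in>circuit_minus p. t e)"
  using assms
proof (induction p)
  case Nil
  then show ?case by (simp add: circuit_plus_def circuit_minus_def)
next
  case (Cons a p)
  obtain e d where a: "a = (e, d)" by fastforce
  have fin: "finite (circuit_plus p)" "finite (circuit_minus p)"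
    unfolding circuit_plus_def circuit_minus_def
    by (rule finite_subset[of _ "fst ` set p"]; force)+
  have "e \<notin> circuit_plus p" "e \<notin> circuit_minus p"
    using Cons.prems a unfolding circuit_plus_def circuit_minus_def by force+
  moreover have "circuit_plus (a # p) = (if d then insert e (circuit_plus p) else circuit_plus p)"
    "circuit_minus (a # p) = (if d then circuit_minus p else insert e (circuit_minus p))"
    using a by (auto simp: circuit_plus_def circuit_minus_def)
  ultimately show ?case using Cons fin a by (auto simp: algebra_simps)
qed

lemma not_distinct_map_decomp:
  assumes "\<not> distinct (map f p)"
  obtains p1 a p2 b p3 where "p = p1 @ [a] @ p2 @ [b] @ p3" "f a = f b"
proof -
  obtain xs y ys zs where "map f p = xs @ [y] @ ys @ [y] @ zs"
    using assms not_distinct_decomp by blast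
  then obtain p1 p' where "p = p1 @ p'" "map f p' = y # ys @ [y] @ zs"
    by (auto simp: map_eq_append_conv)
  moreover from this(2) obtain a p'' where "p' = a # p''" "f a = y" "map f p'' = ys @ [y] @ zs"
    by (auto simp: map_eq_Cons_conv)
  moreover from this(3) obtain p2 q where "p'' = p2 @ q" "map f q = y # zs"
    by (auto simp: map_eq_append_conv)
  moreover from this(2) obtain b p3 where "q = b # p3" "f b = y"
    by (auto simp: map_eq_Cons_conv)
  ultimately show thesis using that by fastforce
qed

text \<open>Induction on the length. A repeated vertex splits the walk into two shorter closed
  walks; an arc traversed both ways cancels and again leaves two shorter closed walks; otherwise the
  walk is empty or a circuit.\<close>

lemma tension_closed_walk:
  assumes "wf_digraph G" "tension G t" "bcas G u p u" "set p \<subseteq> arcs G \<times> UNIV"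
  shows "wsum t p = 0"
  using assms(3,4)
proof (induction "length p" arbitrary: p u rule: less_induct)
  case less
  consider "p = []" | "p \<noteq> []" "\<not> distinct (map (head (both_ways G)) p)"
    | "p \<noteq> []" "distinct (map (head (both_ways G)) p)" "\<not> distinct (map fst p)"
    | "p \<noteq> []" "distinct (map (head (both_ways G)) p)" "distinct (map fst p)" by blast
  then show ?case
  proof cases
    case 1
    then show ?thesis by simp
  next
    case 2
    then obtain p1 a p2 b p3 where p: "p = p1 @ [a] @ p2 @ [b] @ p3"
      and ab: "head (both_ways G) a = head (both_ways G) b"
      using not_distinct_map_decomp by blast
    define y where "y = head (both_ways G) a"
    have "bcas G y (p2 @ [b]) y" "bcas G u (p1 @ [a] @ p3) u"
      using less.prems(1) ab unfolding p y_def by (auto simp: bcas_append)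
    then have zero: "wsum t (p2 @ [b]) = 0" "wsum t (p1 @ [a] @ p3) = 0"
      using less.prems(2) less.hyps[of "p2 @ [b]" y] less.hyps[of "p1 @ [a] @ p3" u] 
      unfolding p by auto
    have "wsum t p = wsum t (p1 @ [a] @ p3) + wsum t (p2 @ [b])"
      unfolding p by (cases a; cases b) (simp add: algebra_simps)
    then show ?thesis unfolding zero by simp
  next
    case 3
    then obtain p1 a p2 b p3 where "p = p1 @ [a] @ p2 @ [b] @ p3" "fst a = fst b"
      using not_distinct_map_decomp by blast
    then obtain e d d' where p: "p = p1 @ [(e, d)] @ p2 @ [(e, d')] @ p3"
      by (metis prod.collapse)
    \<comment> \<open>Equal directions would make two heads coincide.\<close>
    with 3(2) have d': "d' \<longleftrightarrow> \<not> d" by auto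
    have "bcas G (head (both_ways G) (e, d)) p2 (head (both_ways G) (e, d))"
      "bcas G u (p1 @ p3) u"
      using less.prems(1) unfolding p d' by (auto simp: bcas_append split: if_splits)
    then have "wsum t p2 = 0" "wsum t (p1 @ p3) = 0"
      using less.prems(2) less.hyps[of p2] less.hyps[of "p1 @ p3" u]
      unfolding p by auto
    then show ?thesis unfolding p d' by (auto simp: algebra_simps)
  next
    case 4
    have "hd p \<in> arcs G \<times> UNIV" "tail (both_ways G) (hd p) = u"
      using 4(1) less.prems by (cases p; auto)+
    then have u: "u \<in> verts G"
      using wf_digraph.tail_in_verts[OF assms(1)] wf_digraph.head_in_verts[OF assms(1)]
      by (cases "hd p") (auto split: if_splits)
    have "tl (pre_digraph.awalk_verts (both_ways G) u p) = map (head (both_ways G)) p"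
      using 4(1) by (simp add: pre_digraph.awalk_verts_conv'[OF less.prems(1)])
    then have "circuit G p"
      using 4 u less.prems unfolding circuit_def pre_digraph.cycle_def pre_digraph.awalk_def by auto
    then show ?thesis
      using assms(2) 4 by (simp add: wsum_eq_circuit_sums tension_def)
  qed
qed

lemma bcas_reverse:
  "bcas G u p v \<Longrightarrow> bcas G v (rev (map (apsnd Not) p)) u"
  by (induction p arbitrary: u) (auto simp: bcas_append)

lemma wsum_reverse: "wsum t (rev (map (apsnd Not) p)) = - wsum t p"
  by (induction p) auto

text \<open>The walks do not depend on the tension, nor on the group.\<close>

lemma universal_potential:
  fixes G :: "('v, 'e) pre_digraph"
  assumes "wf_digraph G"
  shows "\<exists>W :: 'v \<Rightarrow> ('e \<times> bool) list. (\<forall>v. set (W v) \<subseteq> arcs G \<times> UNIV) \<and>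
    (\<forall>(t :: 'e \<Rightarrow> 'm::ab_group_add) a. tension G t \<longrightarrow> a \<in> arcs G \<longrightarrow>
       t a = wsum t (W (head G a)) - wsum t (W (tail G a)))"
proof -
  interpret wf_digraph G by fact
  define walk where "walk r p v \<longleftrightarrow> bcas G r p v \<and> set p \<subseteq> arcs G \<times> UNIV" for r p v
  \<comment> \<open>\<open>root v\<close> depends on \<open>v\<close> only through the set of
    vertices from which \<open>v\<close> is reachable, so vertices of one component share their
    root.\<close>
  define root where "root v = (SOME r. \<exists>p. walk r p v)" for v
  define W where "W v = (SOME p. walk (root v) p v)" for v
  have W: "walk (root v) (W v) v" for v
  proof -
    have "walk v [] v" by (simp add: walk_def)
    then have "\<exists>r p. walk r p v" by blast
    then have "\<exists>p. walk (root v) p v" unfolding root_def by (rule someI_ex)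
    then show ?thesis unfolding W_def by (rule someI_ex)
  qed
  have "t a = wsum t (W (head G a)) - wsum t (W (tail G a))"
    if t: "tension G t" and a: "a \<in> arcs G" for t :: "'e \<Rightarrow> 'm" and a
  proof -
    let ?u = "tail G a" and ?v = "head G a"
    have "walk r (p @ [(a, True)]) ?v" if "walk r p ?u" for r p
      using that a by (auto simp: walk_def bcas_append)
    moreover have "walk r (p @ [(a, False)]) ?u" if "walk r p ?v" for r p
      using that a by (auto simp: walk_def bcas_append)
    ultimately have "(\<lambda>r. \<exists>p. walk r p ?u) = (\<lambda>r. \<exists>p. walk r p ?v)"
      by metis
    then have r: "root ?u = root ?v" by (simp add: root_def)
    let ?p = "W ?u @ [(a, True)] @ rev (map (apsnd Not) (W ?v))"
    have "bcas G (root ?u) ?p (root ?u)"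
      using W[of ?u] W[of ?v] bcas_reverse[of G "root ?v" "W ?v" ?v] unfolding r walk_def 
      by (auto simp: bcas_append)
    moreover have "set ?p \<subseteq> arcs G \<times> UNIV"
      using W[of ?u] W[of ?v] a unfolding walk_def by auto
    ultimately have "wsum t ?p = 0"
      using tension_closed_walk[OF assms t] by blast
    then show ?thesis by (simp add: wsum_reverse algebra_simps)
  qed
  moreover have "set (W v) \<subseteq> arcs G \<times> UNIV" for v using W by (simp add: walk_def)
  ultimately show ?thesis by (intro exI[of _ W]) simp
qed

text \<open>The signed sum along the chosen walk to a vertex serves as potential there; conversely a
  potential difference telescopes around every circuit.\<close>

lemma tension_iff_potential:
  fixes G :: "('a, 'b) pre_digraph" and t :: "'b \<Rightarrow> 'c::ab_group_add"
  assumes "wf_digraph G"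
  shows "tension G t \<longleftrightarrow> (\<exists>q. \<forall>a\<in>arcs G. t a = q (head G a) - q (tail G a))"
proof
  assume t: "tension G t"
  obtain W where "\<And>(t :: 'b \<Rightarrow> 'c) a. tension G t \<Longrightarrow> a \<in> arcs G \<Longrightarrow>
      t a = wsum t (W (head G a)) - wsum t (W (tail G a))"
    using universal_potential[OF assms, where 'm = 'c] by metis
  with t have "\<forall>a\<in>arcs G. t a = wsum t (W (head G a)) - wsum t (W (tail G a))" by blast
  then show "\<exists>q. \<forall>a\<in>arcs G. t a = q (head G a) - q (tail G a)"
    by (intro exI[of _ "\<lambda>v. wsum t (W v)"]) simp
next
  assume "\<exists>q. \<forall>a\<in>arcs G. t a = q (head G a) - q (tail G a)"
  then obtain q where q: "\<forall>a\<in>arcs G. t a = q (head G a) - q (tail G a)" by blast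
  show "tension G t" unfolding tension_def
  proof (intro allI impI)
    fix C assume C: "circuit G C"
    then obtain u where u: "bcas G u C u" "set C \<subseteq> arcs G \<times> UNIV"
      by (auto simp: circuit_def pre_digraph.cycle_def pre_digraph.awalk_def)
    have "wsum t C = wsum (\<lambda>a. q (head G a) - q (tail G a)) C"
      by (rule wsum_cong) (use u q in auto)
    also have "\<dots> = 0" using u by (simp add: wsum_potential)
    finally show "sum t (circuit_plus C) = sum t (circuit_minus C)"
      using C by (simp add: wsum_eq_circuit_sums circuit_def)
  qed
qed

lemma tension_potentialE:
  assumes "wf_digraph G" "tension G t"
  obtains q where "\<forall>a\<in>arcs G. t a = q (head G a) - q (tail G a)"
  using assms(2) unfolding tension_iff_potential[OF assms(1)] by (elim exE)

section \<open>The two quasiorders and how they compare\<close>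

lemma tension_cong:
  assumes "wf_digraph G" "\<And>a. a \<in> arcs G \<Longrightarrow> s a = t a"
  shows "tension G s \<longleftrightarrow> tension G t"
  unfolding tension_iff_potential[OF assms(1)] using assms(2) by auto

lemma tension_le_trans:
  assumes "tension_le M G H" "tension_le M H K"
  shows "tension_le M G K"
proof -
  obtain f g where "tension_continuous M G H f" "tension_continuous M H K g"
    using assms unfolding tension_le_def by blast
  then have "tension_continuous M G K (g \<circ> f)"
    unfolding tension_continuous_def by (auto simp: o_assoc)
  then show ?thesis unfolding tension_le_def by blast
qed

lemma hom_le_trans:
  assumes "hom_le G H" "hom_le H K"
  shows "hom_le G K"
proof -
  obtain f g where "digraph_hom G H f" "digraph_hom H K g"
    using assms unfolding hom_le_def by blast
  then have "digraph_hom G K (g \<circ> f)" unfolding digraph_hom_def by fastforce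
  then show ?thesis unfolding hom_le_def by blast
qed

lemma hom_leI:
  assumes "\<And>v. v \<in> verts G \<Longrightarrow> h v \<in> verts H" "\<And>a. a \<in> arcs G \<Longrightarrow> f a \<in> arcs H"
    "\<And>a. a \<in> arcs G \<Longrightarrow> tail H (f a) = h (tail G a)"
    "\<And>a. a \<in> arcs G \<Longrightarrow> head H (f a) = h (head G a)"
  shows "hom_le G H"
proof -
  have "digraph_hom G H h"
    using assms unfolding digraph_hom_def arcs_ends_conv by (auto simp: image_iff) metis
  then show ?thesis unfolding hom_le_def by blast
qed

text \<open>A homomorphism pulls back potentials. Among parallel arcs the image of an arc may be
  chosen arbitrarily, since only its ends enter.\<close>

lemma hom_le_imp_tension_le:
  fixes G :: "('v, 'e) pre_digraph" and H :: "('w, 'f) pre_digraph"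
    and M :: "'m::ab_group_add itself"
  assumes "wf_digraph G" "wf_digraph H" "hom_le G H"
  shows "tension_le M G H"
proof -
  obtain h where h: "digraph_hom G H h" using assms(3) unfolding hom_le_def by blast
  have "\<forall>a\<in>arcs G. \<exists>b\<in>arcs H. h (tail G a) = tail H b \<and> h (head G a) = head H b"
    using h unfolding digraph_hom_def arcs_ends_conv by force
  then obtain f where f: "\<And>a. a \<in> arcs G \<Longrightarrow>
      f a \<in> arcs H \<and> h (tail G a) = tail H (f a) \<and> h (head G a) = head H (f a)"
    by metis
  have "tension G (t \<circ> f)" if t: "tension H t" for t :: "'f \<Rightarrow> 'm"
  proof -
    obtain q where "\<forall>b\<in>arcs H. t b = q (head H b) - q (tail H b)"
      using assms(2) t by (rule tension_potentialE)
    then show ?thesis unfolding tension_iff_potential[OF assms(1)]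
      using f by (intro exI[of _ "q \<circ> h"]) simp
  qed
  then have "tension_continuous M G H f" unfolding tension_continuous_def using f by auto
  then show ?thesis unfolding tension_le_def by blast
qed

text \<open>The theorem asks for a graph on natural numbers. Homomorphisms in both directions
  suffice to transfer both quasiorders.\<close>

lemma nat_copy:
  assumes "fin_digraph K"
  obtains K' :: "(nat, nat) pre_digraph" where "fin_digraph K'" "hom_le K K'" "hom_le K' K"
proof -
  interpret fin_digraph K by fact
  obtain f :: "'a \<Rightarrow> nat" and g :: "'b \<Rightarrow> nat" where f: "inj_on f (verts K)" and g: "inj_on g (arcs K)"
    using finite_imp_inj_to_nat_seg finite_verts finite_arcs by metis
  define K' where "K' = \<lparr>verts = f ` verts K, arcs = g ` arcs K,
    tail = f \<circ> tail K \<circ> inv_into (arcs K) g, head = f \<circ> head K \<circ> inv_into (arcs K) g\<rparr>"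
  show thesis
  proof
    show "fin_digraph K'" by unfold_locales (auto simp: K'_def g)
    show "hom_le K K'" by (rule hom_leI[of _ f _ g]) (auto simp: K'_def g)
    show "hom_le K' K"
      by (rule hom_leI[of _ "inv_into (verts K) f" _ "inv_into (arcs K) g"]) (auto simp: K'_def f g)
  qed
qed

section \<open>Residual finiteness\<close>

text \<open>
  Residual finiteness of the quotient of \<open>\<int>\<^sup>E\<close> by a subgroup \<open>L\<close>. In the induction step, an
  element of \<open>L\<close> whose \<open>a\<close>-coordinate generates the \<open>a\<close>-coordinates of \<open>L\<close> is used to
  clear the \<open>a\<close>-coordinate.
\<close>

lemma separating_modulus:
  fixes L :: "('e \<Rightarrow> int) set"
  assumes "finite E" "(\<lambda>_. 0) \<in> L" "\<And>x y. x \<in> L \<Longrightarrow> y \<in> L \<Longrightarrow> (\<lambda>e. x e - y e) \<in> L"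
    and "\<And>x e. x \<in> L \<Longrightarrow> e \<notin> E \<Longrightarrow> x e = 0"
    and "\<And>e. e \<notin> E \<Longrightarrow> z e = 0" "z \<notin> L"
  shows "\<exists>N::int>0. \<forall>l\<in>L. \<forall>w. z \<noteq> (\<lambda>e. l e + N * w e)"
  using assms
proof (induction E arbitrary: L z rule: finite_induct)
  case empty
  then have "z = (\<lambda>_. 0)" by auto
  with empty show ?case by auto
next
  case (insert a E)
  note zero = insert.prems(1) and diff = insert.prems(2) and supp = insert.prems(3)
  have neg: "(\<lambda>e. - x e) \<in> L" if "x \<in> L" for x
    using diff[OF zero that] by simp
  have add: "(\<lambda>e. x e + y e) \<in> L" if "x \<in> L" "y \<in> L" for x y
    using diff[OF that(1) neg[OF that(2)]] by simp
  have scale_nat: "(\<lambda>e. int k * x e) \<in> L" if "x \<in> L" for x k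
  proof (induction k)
    case (Suc k)
    from add[OF this that] show ?case by (simp add: algebra_simps)
  qed (use zero in simp)
  have scale: "(\<lambda>e. k * x e) \<in> L" if "x \<in> L" for x and k :: int
  proof (cases "k \<ge> 0")
    case True
    then show ?thesis using scale_nat[OF that, of "nat k"] by simp
  next
    case False
    then show ?thesis using neg[OF scale_nat[OF that, of "nat (-k)"]] by simp
  qed
  \<comment> \<open>Vectors in \<open>L0\<close> are supported on \<open>E\<close>, so the induction
    hypothesis applies to this subgroup.\<close>
  define L0 where "L0 = {x \<in> L. x a = 0}"
  have IH: "\<exists>N>0. \<forall>l\<in>L0. \<forall>w. y \<noteq> (\<lambda>e. l e + N * w e)"
    if "y a = 0" "y \<notin> L" "\<And>e. e \<notin> insert a E \<Longrightarrow> y e = 0" for y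
  proof (rule insert.IH)
    show "(\<lambda>_. 0) \<in> L0" using zero by (simp add: L0_def)
    show "(\<lambda>e. x e - x' e) \<in> L0" if "x \<in> L0" "x' \<in> L0" for x x'
      using that diff by (auto simp: L0_def)
    show "x e = 0" if "x \<in> L0" "e \<notin> E" for x e
      using that supp by (cases "e = a") (auto simp: L0_def)
    show "y e = 0" if "e \<notin> E" for e
      using that \<open>y a = 0\<close> \<open>\<And>e. e \<notin> insert a E \<Longrightarrow> y e = 0\<close> by (cases "e = a") auto
    show "y \<notin> L0" using \<open>y \<notin> L\<close> by (simp add: L0_def)
  qed
  show ?case
  proof (cases "\<exists>x\<in>L. x a \<noteq> 0")
    case False
    show ?thesis
    proof (cases "z a = 0")
      case True
      with False IH[OF True insert.prems(5,4)] show ?thesis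
        unfolding L0_def by (metis (mono_tags, lifting) mem_Collect_eq)
    next
      case z: False
      \<comment> \<open>All of \<open>L\<close> vanishes at \<open>a\<close>, and the nonzero number
        \<open>z a\<close> is no multiple of the larger modulus.\<close>
      have "z a \<noteq> l a + (\<bar>z a\<bar> + 1) * w a" if "l \<in> L" for l w
      proof
        assume "z a = l a + (\<bar>z a\<bar> + 1) * w a"
        then have "z a = (\<bar>z a\<bar> + 1) * w a" using that False by auto
        then have "\<bar>z a\<bar> + 1 dvd z a" by (metis dvd_triv_left)
        with z show False using zdvd_not_zless[of "\<bar>z a\<bar>" "\<bar>z a\<bar> + 1"] by (auto dest: dvd_imp_le_int)
      qed
      then show ?thesis by (intro exI[of _ "\<bar>z a\<bar> + 1"]) (auto simp: fun_eq_iff)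
    qed
  next
    case True
    \<comment> \<open>The positive generator of the group of \<open>a\<close>-coordinates of
      \<open>L\<close>; \<open>dvd\<close> below confirms this by division with remainder.\<close>
    define d where "d = (LEAST d. d > 0 \<and> (\<exists>x\<in>L. x a = int d))"
    obtain x where x: "x \<in> L" "x a \<noteq> 0" using True by blast
    have "\<exists>d>0. \<exists>x\<in>L. x a = int d"
    proof (cases "x a > 0")
      case True
      then show ?thesis using x by (intro exI[of _ "nat (x a)"]) auto
    next
      case False
      then show ?thesis using x neg[OF x(1)]
        by (intro exI[of _ "nat (- x a)"]) (auto intro!: bexI[of _ "\<lambda>e. - x e"])
    qed
    then have "d > 0 \<and> (\<exists>x\<in>L. x a = int d)" unfolding d_def by (rule LeastI_ex)
    then obtain y where d: "d > 0" and y: "y \<in> L" "y a = int d" by blast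
    have dvd: "int d dvd x a" if "x \<in> L" for x
    proof (rule ccontr)
      assume "\<not> int d dvd x a"
      then have r: "x a mod int d > 0" "x a mod int d < int d"
        using d pos_mod_sign[of "int d" "x a"] by (auto simp: dvd_eq_mod_eq_0 order_le_less)
      let ?x = "\<lambda>e. x e - (x a div int d) * y e"
      have "?x a = x a mod int d" using y by (simp add: minus_div_mult_eq_mod)
      moreover have "?x \<in> L" using diff[OF that scale[OF y(1)]] by simp
      ultimately have "\<exists>x'\<in>L. x' a = int (nat (x a mod int d))" 
        using r by (intro bexI[of _ ?x]) auto
      then have "d \<le> nat (x a mod int d)"
        using r by (subst d_def, intro Least_le) simp
      with r show False by linarith
    qed
    show ?thesis
    proof (cases "int d dvd z a")
      case False
      have "z a \<noteq> l a + int d * w a" if "l \<in> L" for l w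
        using dvd[OF that] False by (metis dvd_add dvd_triv_left)
      then show ?thesis using d by (intro exI[of _ "int d"]) (auto simp: fun_eq_iff)
    next
      case True
      then obtain k where k: "z a = int d * k" by blast
      define z' where "z' = (\<lambda>e. z e - k * y e)"
      have "z' \<notin> L"
      proof
        assume "z' \<in> L"
        from add[OF this scale[OF y(1), of k]] have "z \<in> L" by (simp add: z'_def)
        with insert.prems(5) show False by simp
      qed
      moreover have "z' a = 0" using k y by (simp add: z'_def)
      moreover have "z' e = 0" if "e \<notin> insert a E" for e
        using insert.prems(4) supp[OF y(1)] that by (simp add: z'_def)
      ultimately obtain N where N: "N > 0" "\<And>l w. l \<in> L0 \<Longrightarrow> z' \<noteq> (\<lambda>e. l e + N * w e)"
        using IH[of z'] by blast
      \<comment> \<open>The factor \<open>int d\<close> in the modulus makes \<open>l a\<close>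
        equal to \<open>int d * (k - N * w a)\<close>. Subtracting \<open>k - N * w a\<close> times
        \<open>y\<close> moves \<open>l\<close> into \<open>L0\<close>, and what remains of
        \<open>z'\<close> is still a multiple of \<open>N\<close>.\<close>
      have "z \<noteq> (\<lambda>e. l e + N * int d * w e)" if l: "l \<in> L" for l w
      proof
        assume z: "z = (\<lambda>e. l e + N * int d * w e)"
        let ?l = "\<lambda>e. l e - (k - N * w a) * y e"
        have "?l \<in> L" using diff[OF l scale[OF y(1)]] by simp
        moreover have "?l a = 0" using k y fun_cong[OF z, of a] by (simp add: algebra_simps)
        ultimately have "?l \<in> L0" by (simp add: L0_def)
        moreover have "z' = (\<lambda>e. ?l e + N * (int d * w e - w a * y e))"
          unfolding z'_def by (subst z) (auto simp: algebra_simps)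
        ultimately show False using N(2)[of ?l "\<lambda>e. int d * w e - w a * y e"] by blast
      qed
      then show ?thesis using N(1) d by (intro exI[of _ "N * int d"]) auto
    qed
  qed
qed

text \<open>Only finitely many vectors in the box lie outside \<open>L\<close>. Each has its own
  modulus, and the product serves them all, as multiples of a separating modulus still
  separate.\<close>

lemma separating_modulus_box:
  fixes L :: "('e \<Rightarrow> int) set" and b :: int
  assumes "finite E" "(\<lambda>_. 0) \<in> L" "\<And>x y. x \<in> L \<Longrightarrow> y \<in> L \<Longrightarrow> (\<lambda>e. x e - y e) \<in> L"
    and "\<And>x e. x \<in> L \<Longrightarrow> e \<notin> E \<Longrightarrow> x e = 0"
  shows "\<exists>N::int>0. \<forall>z l w. (\<forall>e. \<bar>z e\<bar> \<le> b) \<longrightarrow> (\<forall>e. e \<notin> E \<longrightarrow> z e = 0) \<longrightarrow>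
    l \<in> L \<longrightarrow> z = (\<lambda>e. l e + N * w e) \<longrightarrow> z \<in> L"
proof -
  define Z where "Z = {z. (\<forall>e. e \<in> E \<longrightarrow> z e \<in> {-b..b}) \<and> (\<forall>e. e \<notin> E \<longrightarrow> z e = 0) \<and> z \<notin> L}"
  have "finite Z"
    by (rule finite_subset[OF _ finite_set_of_finite_funs[OF assms(1), of "{-b..b}" 0]])
      (auto simp: Z_def)
  have "\<forall>z\<in>Z. \<exists>N::int>0. \<forall>l\<in>L. \<forall>w. z \<noteq> (\<lambda>e. l e + N * w e)"
    using separating_modulus[of E L] assms by (simp add: Z_def)
  then obtain N where N: "\<And>z. z \<in> Z \<Longrightarrow> N z > (0::int)"
    "\<And>z l w. z \<in> Z \<Longrightarrow> l \<in> L \<Longrightarrow> z \<noteq> (\<lambda>e. l e + N z * w e)" by metis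
  show ?thesis
  proof (intro exI[of _ "\<Prod>z\<in>Z. N z"] conjI allI impI)
    show "(\<Prod>z\<in>Z. N z) > 0" using N(1) by (rule prod_pos)
    fix z l and w :: "'e \<Rightarrow> int"
    assume z: "\<forall>e. \<bar>z e\<bar> \<le> b" "\<forall>e. e \<notin> E \<longrightarrow> z e = 0" "l \<in> L"
      "z = (\<lambda>e. l e + (\<Prod>z\<in>Z. N z) * w e)"
    show "z \<in> L"
    proof (rule ccontr)
      assume "z \<notin> L"
      then have "z \<in> Z" using z(1,2) by (auto simp: Z_def abs_le_iff minus_le_iff)
      then have prod: "(\<Prod>z\<in>Z. N z) = N z * (\<Prod>z\<in>Z-{z}. N z)"
        using \<open>finite Z\<close> by (simp add: prod.remove)
      have "z e = l e + N z * ((\<Prod>z\<in>Z-{z}. N z) * w e)" for e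
        using fun_cong[OF z(4), of e] by (simp add: prod mult.assoc)
      then have "z = (\<lambda>e. l e + N z * ((\<Prod>z\<in>Z-{z}. N z) * w e))" by blast
      then show False using N(2)[OF \<open>z \<in> Z\<close> z(3), of "\<lambda>e. (\<Prod>z\<in>Z-{z}. N z) * w e"] by blast
    qed
  qed
qed

section \<open>Sparse sets of arcs hitting all pairs of large sets\<close>

text \<open>
  Labelled arcs \<open>(e, u, v)\<close> on the vertices \<open>{..<n}\<close>. For nontrivial \<open>M\<close>, every
  function on a set of arcs is a potential difference iff the set is a forest, so \<open>sparse\<close> says
  that the girth exceeds \<open>g\<close>.
\<close>

definition sparse :: "'m::ab_group_add itself \<Rightarrow> nat \<Rightarrow> ('e \<times> nat \<times> nat) set \<Rightarrow> bool" where
  "sparse M g F \<longleftrightarrow> (\<forall>T\<subseteq>F. card T \<le> g \<longrightarrow>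
     (\<forall>s :: 'e \<times> nat \<times> nat \<Rightarrow> 'm. \<exists>q. \<forall>(e, u, v)\<in>T. s (e, u, v) = q v - q u))"

definition linked :: "('e \<times> nat \<times> nat) set \<Rightarrow> (nat \<times> nat) set" where
  "linked F = (\<lambda>(e, u, v). (u, v)) ` F \<union> (\<lambda>(e, u, v). (v, u)) ` F"

definition incident :: "('e \<times> nat \<times> nat) set \<Rightarrow> nat \<Rightarrow> ('e \<times> nat \<times> nat) set" where
  "incident F u = {(e, a, b) \<in> F. a = u \<or> b = u}"

text \<open>Distance at most \<open>k\<close> in the undirected graph. The term \<open>i = 0\<close>
  contributes the diagonal, so pairs outside \<open>near\<close> are no loops.\<close>

definition near :: "nat \<Rightarrow> ('e \<times> nat \<times> nat) set \<Rightarrow> (nat \<times> nat) set" where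
  "near k F = (\<Union>i\<le>k. linked F ^^ i)"

text \<open>The tasks left to the greedy construction. Both vertex sets have density at least
  \<open>1 / r\<close>, which is written without division.\<close>

definition unhit ::
  "'e set \<Rightarrow> nat \<Rightarrow> nat \<Rightarrow> ('e \<times> nat \<times> nat) set \<Rightarrow> ('e \<times> nat set \<times> nat set) set" where
  "unhit I r n F = {(e, A, B). e \<in> I \<and> A \<subseteq> {..<n} \<and> B \<subseteq> {..<n} \<and>
     n \<le> r * card A \<and> n \<le> r * card B \<and> (\<forall>a\<in>A. \<forall>b\<in>B. (e, a, b) \<notin> F)}"

lemma finite_linked: "finite F \<Longrightarrow> finite (linked F)"
  by (simp add: linked_def)

lemma card_linked:
  assumes "finite F"
  shows "card (linked F) \<le> 2 * card F"
proof -
  have "card (linked F) \<le> card ((\<lambda>(e, u, v). (u, v)) ` F) + card ((\<lambda>(e, u, v). (v, u)) ` F)"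
    unfolding linked_def by (rule card_Un_le)
  also have "\<dots> \<le> card F + card F" using assms by (intro add_mono card_image_le)
  finally show ?thesis by simp
qed

lemma relpow_mono':
  fixes R S :: "('a \<times> 'a) set"
  shows "R \<subseteq> S \<Longrightarrow> R ^^ k \<subseteq> S ^^ k"
  by (induction k) auto

text \<open>At most \<open>g\<close> old arcs cannot connect \<open>u\<close> to \<open>v\<close>. A
  potential for them can therefore be shifted outside the component of \<open>u\<close> until the
  new arc also gets its prescribed value.\<close>

lemma sparse_insert:
  fixes M :: "'m::ab_group_add itself"
  assumes "finite F" "sparse M g F" "(u, v) \<notin> near (2 * g) F"
  shows "sparse M g (insert (e, u, v) F)"
  unfolding sparse_def
proof (intro allI impI)
  fix T and s :: "'a \<times> nat \<times> nat \<Rightarrow> 'm"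
  assume T: "T \<subseteq> insert (e, u, v) F" "card T \<le> g"
  define T' where "T' = T - {(e, u, v)}"
  have fin: "finite T" "finite T'" using T(1) assms(1) by (auto simp: T'_def intro: finite_subset)
  have T': "T' \<subseteq> F" "card T' \<le> g"
    using T card_mono[OF fin(1), of T'] by (auto simp: T'_def)
  then obtain q where q: "\<forall>(e, u, v)\<in>T'. s (e, u, v) = q v - q u"
    using assms(2) unfolding sparse_def by blast
  define C where "C = {w. (u, w) \<in> (linked T')\<^sup>*}"
  have C: "a \<in> C \<longleftrightarrow> b \<in> C" if "(c, a, b) \<in> T'" for a b c
  proof -
    have "(a, b) \<in> linked T'" "(b, a) \<in> linked T'" using that by (force simp: linked_def)+
    then show ?thesis unfolding C_def by (auto intro: rtrancl_into_rtrancl)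
  qed
  have "v \<notin> C"
  proof
    assume "v \<in> C"
    \<comment> \<open>The number of steps needed is at most the number of linked pairs, and each arc
      contributes at most two; hence the radius \<open>2 * g\<close>.\<close>
    then obtain k where k: "k \<le> card (linked T')" "(u, v) \<in> linked T' ^^ k"
      unfolding C_def using finite_linked[OF fin(2)] by (auto simp: rtrancl_finite_eq_relpow)
    have "k \<le> 2 * g" using k(1) card_linked[OF fin(2)] T'(2) by linarith
    moreover have "linked T' \<subseteq> linked F" using T'(1) unfolding linked_def by (intro Un_mono image_mono)
    ultimately have "(u, v) \<in> near (2 * g) F"
      using k(2) relpow_mono' unfolding near_def by blast
    with assms(3) show False by blast
  qed
  have "u \<in> C" by (simp add: C_def)
  define q' where "q' w = (if w \<in> C then q w else q w + (s (e, u, v) - q v + q u))" for w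
  have "s (c, a, b) = q' b - q' a" if "(c, a, b) \<in> T" for a b c
  proof (cases "(c, a, b) \<in> T'")
    case True
    then have "s (c, a, b) = q b - q a" using q by auto
    then show ?thesis using C[OF True] by (simp add: q'_def)
  next
    case False
    then have "(c, a, b) = (e, u, v)" using that by (auto simp: T'_def)
    then show ?thesis using \<open>u \<in> C\<close> \<open>v \<notin> C\<close> by (simp add: q'_def)
  qed
  then show "\<exists>q. \<forall>(e, u, v)\<in>T. s (e, u, v) = q v - q u" by blast
qed

lemma near_ball:
  assumes "finite F" "\<And>u. card (incident F u) \<le> D"
  shows "finite (near k F `` {u}) \<and> card (near k F `` {u}) \<le> (\<Sum>i\<le>k. D ^ i)"
proof -
  have link: "finite (linked F `` {a}) \<and> card (linked F `` {a}) \<le> D" for a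
  proof -
    have sub: "linked F `` {a} \<subseteq> (\<lambda>(e, x, y). if x = a then y else x) ` incident F a"
    proof
      fix b assume "b \<in> linked F `` {a}"
      then have "\<exists>e. (e, a, b) \<in> F \<or> (e, b, a) \<in> F" by (auto simp: linked_def)
      then obtain e where "(e, a, b) \<in> F \<or> (e, b, a) \<in> F" by blast
      then show "b \<in> (\<lambda>(e, x, y). if x = a then y else x) ` incident F a"
        by (auto simp: incident_def intro: rev_image_eqI[of "(e, a, b)"] rev_image_eqI[of "(e, b, a)"])
    qed
    have "finite (incident F a)"
      by (rule finite_subset[OF _ assms(1)]) (auto simp: incident_def)
    then show ?thesis
      using sub assms(2)[of a] surj_card_le[OF _ sub] by (meson finite_imageI finite_subset le_trans)
  qed
  have ball: "finite ((linked F ^^ i) `` {u}) \<and> card ((linked F ^^ i) `` {u}) \<le> D ^ i" for i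
  proof (induction i)
    case (Suc i)
    have eq: "(linked F ^^ Suc i) `` {u} = (\<Union>a\<in>(linked F ^^ i) `` {u}. linked F `` {a})" by auto
    have "card ((linked F ^^ Suc i) `` {u}) \<le> (\<Sum>a\<in>(linked F ^^ i) `` {u}. card (linked F `` {a}))"
      unfolding eq using Suc by (intro card_UN_le) simp
    also have "\<dots> \<le> card ((linked F ^^ i) `` {u}) * D"
      using link sum_bounded_above[of "(linked F ^^ i) `` {u}" "\<lambda>a. card (linked F `` {a})" D] by simp
    also have "\<dots> \<le> D ^ i * D" using Suc by (intro mult_right_mono) auto
    finally show ?case using Suc link unfolding eq by (simp add: mult.commute)
  qed simp
  have eq: "near k F `` {u} = (\<Union>i\<le>k. (linked F ^^ i) `` {u})" by (auto simp: near_def)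
  have "card (near k F `` {u}) \<le> (\<Sum>i\<le>k. card ((linked F ^^ i) `` {u}))"
    unfolding eq by (intro card_UN_le) simp
  also have "\<dots> \<le> (\<Sum>i\<le>k. D ^ i)" using ball by (intro sum_mono) simp
  finally show ?thesis using ball unfolding eq by simp
qed

text \<open>Double counting: an arc is incident with at most two vertices.\<close>

lemma sum_card_incident:
  assumes "finite F" "finite S"
  shows "(\<Sum>u\<in>S. card (incident F u)) \<le> 2 * card F"
proof -
  have "(\<Sum>u\<in>S. card (incident F u)) = (\<Sum>u\<in>S. \<Sum>x\<in>F. if x \<in> incident F u then 1 else 0)"
    using assms(1) by (intro sum.cong) (auto simp: sum.If_cases incident_def intro!: arg_cong[of _ _ card])
  also have "\<dots> = (\<Sum>x\<in>F. \<Sum>u\<in>S. if x \<in> incident F u then 1 else 0)" by (rule sum.swap)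
  also have "\<dots> \<le> (\<Sum>x\<in>F. 2)"
  proof (rule sum_mono)
    fix x assume "x \<in> F"
    obtain e a b where x: "x = (e, a, b)" using prod_cases3 by blast
    have "(\<Sum>u\<in>S. if x \<in> incident F u then 1 else 0) = card {u\<in>S. x \<in> incident F u}"
      using assms(2) by (simp add: sum.If_cases Int_def)
    also have "\<dots> \<le> card {a, b}" by (rule card_mono) (auto simp: x incident_def)
    also have "\<dots> \<le> 2" by (simp add: card_insert_if)
    finally show "(\<Sum>u\<in>S. if x \<in> incident F u then 1 else 0) \<le> (2::nat)" .
  qed
  finally show ?thesis by simp
qed

text \<open>
  One greedy step: most pairs \<open>(u, v)\<close> are far apart and have degrees below \<open>D\<close>, so some such
  pair hits at least the average share of what is still unhit.
\<close>

lemma greedy_step: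
  fixes M :: "'m::ab_group_add itself" and r n D g :: nat
  assumes "finite I" "F \<subseteq> I \<times> {..<n} \<times> {..<n}" "sparse M g F"
    and deg: "\<And>u. card (incident F u) \<le> D"
    and D: "D > 0" "16 * r\<^sup>2 * card F \<le> D * n"
    and n: "n > 0" "4 * r\<^sup>2 * (\<Sum>i\<le>2 * g. D ^ i) \<le> n"
  obtains F' where "F' \<subseteq> I \<times> {..<n} \<times> {..<n}" "sparse M g F'"
    "\<And>u. card (incident F' u) \<le> D" "card F' \<le> Suc (card F)"
    "2 * r\<^sup>2 * card I * card (unhit I r n F') \<le> (2 * r\<^sup>2 * card I - 1) * card (unhit I r n F)"
proof -
  have fin: "finite F" using assms(1,2) by (meson finite_SigmaI finite_lessThan finite_subset)
  define U where "U = unhit I r n F"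
  have "U \<subseteq> I \<times> Pow {..<n} \<times> Pow {..<n}" by (auto simp: U_def unhit_def)
  then have finU: "finite U"
    by (rule finite_subset) (use assms(1) in simp)
  \<comment> \<open>Saturated vertices. The new arc avoids them, which preserves the degree
    bound.\<close>
  define S where "S = {u. u < n \<and> card (incident F u) = D}"
  define P where "P = {(u, v). u < n \<and> v < n \<and> u \<notin> S \<and> v \<notin> S \<and> (u, v) \<notin> near (2 * g) F}"
  have [simp]: "finite S" "finite P"
    by (auto simp: S_def P_def intro: finite_subset[of _ "{..<n} \<times> {..<n}"])
  define bad where "bad = {..<n} \<times> {..<n} - P"
  have [simp]: "finite bad" by (simp add: bad_def)
  have "D * card S = (\<Sum>u\<in>S. card (incident F u))" by (simp add: S_def)
  also have "\<dots> \<le> 2 * card F" by (rule sum_card_incident) (simp_all add: fin)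
  finally have "D * (8 * r\<^sup>2 * card S) \<le> 8 * r\<^sup>2 * (2 * card F)"
    by (simp add: mult.left_commute)
  also have "\<dots> \<le> D * n" using D(2) by simp
  finally have S: "8 * r\<^sup>2 * card S \<le> n" using D(1) by simp
  \<comment> \<open>A pair is bad because its first end is saturated, its second end is, or the two
    are close. After multiplication by \<open>4 * r\<^sup>2\<close>, the first two kinds together
    and the third contribute at most \<open>n * n\<close> each.\<close>
  have "bad \<subseteq> S \<times> {..<n} \<union> {..<n} \<times> S \<union> (SIGMA u:{..<n}. near (2 * g) F `` {u})"
    by (auto simp: bad_def P_def)
  moreover have "finite (SIGMA u:{..<n}. near (2 * g) F `` {u})"
    using near_ball[OF fin deg] by (intro finite_SigmaI) auto
  ultimately have "card bad \<le> card (S \<times> {..<n} \<union> {..<n} \<times> S \<union> (SIGMA u:{..<n}. near (2 * g) F `` {u}))"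
    by (intro card_mono) auto
  also have "\<dots> \<le> card (S \<times> {..<n}) + card ({..<n} \<times> S) + card (SIGMA u:{..<n}. near (2 * g) F `` {u})"
    by (meson add_le_mono card_Un_le le_refl le_trans)
  also have "card (SIGMA u:{..<n}. near (2 * g) F `` {u}) = (\<Sum>u<n. card (near (2 * g) F `` {u}))"
    using near_ball[OF fin deg] by (intro card_SigmaI) auto
  also have "\<dots> \<le> (\<Sum>u<n. \<Sum>i\<le>2 * g. D ^ i)"
    using near_ball[OF fin deg] by (intro sum_mono) auto
  finally have "card bad \<le> 2 * (card S * n) + n * (\<Sum>i\<le>2 * g. D ^ i)"
    by (simp add: card_cartesian_product mult.commute)
  then have "4 * r\<^sup>2 * card bad \<le> 4 * r\<^sup>2 * (2 * (card S * n) + n * (\<Sum>i\<le>2 * g. D ^ i))"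
    by (rule mult_left_mono) simp
  also have "\<dots> = (8 * r\<^sup>2 * card S) * n + n * (4 * r\<^sup>2 * (\<Sum>i\<le>2 * g. D ^ i))"
    by (simp add: algebra_simps)
  also have "\<dots> \<le> n * n + n * n" by (intro add_mono mult_mono S n(2)) auto
  finally have bad: "2 * r\<^sup>2 * card bad \<le> n\<^sup>2" by (simp add: power2_eq_square)
  \<comment> \<open>There are at least \<open>n\<^sup>2 / r\<^sup>2\<close> pairs in
    \<open>A \<times> B\<close>, and at most half that many bad pairs.\<close>
  have many: "n\<^sup>2 \<le> 2 * r\<^sup>2 * card (P \<inter> A \<times> B)" if "(e, A, B) \<in> U" for e A B
  proof -
    have AB: "A \<subseteq> {..<n}" "B \<subseteq> {..<n}" "n \<le> r * card A" "n \<le> r * card B"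
      using that by (auto simp: U_def unhit_def)
    then have [simp]: "finite A" "finite B" by (auto intro: finite_subset)
    have "n * n \<le> (r * card A) * (r * card B)" using AB by (intro mult_mono) auto
    then have "2 * n\<^sup>2 \<le> 2 * r\<^sup>2 * card (A \<times> B)"
      by (simp add: power2_eq_square card_cartesian_product algebra_simps)
    moreover have "card (A \<times> B) \<le> card (P \<inter> A \<times> B) + card bad"
      using card_Un_le[of "P \<inter> A \<times> B" bad] card_mono[of "P \<inter> A \<times> B \<union> bad" "A \<times> B"] AB
      by (force simp: bad_def)
    then have "2 * r\<^sup>2 * card (A \<times> B) \<le> 2 * r\<^sup>2 * card (P \<inter> A \<times> B) + 2 * r\<^sup>2 * card bad"
      by (metis add_mult_distrib2 mult_le_mono2)
    ultimately show ?thesis using bad by linarith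
  qed
  define hits where "hits x = {(e, A, B) \<in> U. fst x = e \<and> snd x \<in> A \<times> B}" for x
  have finh: "finite (hits x)" "card (hits x) \<le> card U" for x
    using finU by (auto simp: hits_def intro: finite_subset card_mono)
  have "(\<Sum>x\<in>I \<times> P. card (hits x)) = (\<Sum>x\<in>I \<times> P. \<Sum>y\<in>U. if y \<in> hits x then 1 else 0)"
    using finU by (intro sum.cong) (auto simp: sum.If_cases hits_def intro!: arg_cong[of _ _ card])
  also have "\<dots> = (\<Sum>y\<in>U. \<Sum>x\<in>I \<times> P. if y \<in> hits x then 1 else 0)" by (rule sum.swap)
  also have "\<dots> = (\<Sum>(e, A, B)\<in>U. card (P \<inter> A \<times> B))"
  proof (rule sum.cong, goal_cases)
    case (2 y)
    obtain e A B where y: "y = (e, A, B)" using prod_cases3 by blast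
    have e: "e \<in> I" using 2 by (auto simp: y U_def unhit_def)
    have "(\<Sum>x\<in>I \<times> P. if y \<in> hits x then 1 else 0) = card {x\<in>I \<times> P. y \<in> hits x}"
      using assms(1) by (simp add: sum.If_cases Int_def)
    also have "{x\<in>I \<times> P. y \<in> hits x} = Pair e ` (P \<inter> A \<times> B)"
      using 2 e by (auto simp: y hits_def)
    also have "card \<dots> = card (P \<inter> A \<times> B)" by (intro card_image) (auto simp: inj_on_def)
    finally show ?case by (simp add: y)
  qed simp
  finally have count: "(\<Sum>x\<in>I \<times> P. card (hits x)) = (\<Sum>(e, A, B)\<in>U. card (P \<inter> A \<times> B))" .
  show thesis
  proof (cases "U = {}")
    case True
    show ?thesis by (rule that[of F]) (use assms True in \<open>auto simp: U_def\<close>)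
  next
    case False
    \<comment> \<open>Averaging: every member of \<open>U\<close> is hit by at least
      \<open>n\<^sup>2 / (2 * r\<^sup>2)\<close> of the at most \<open>card I * n\<^sup>2\<close>
      candidate arcs, so some candidate hits a share of at least
      \<open>1 / (2 * r\<^sup>2 * card I)\<close>.\<close>
    have "\<exists>x\<in>I \<times> P. card U \<le> 2 * r\<^sup>2 * card I * card (hits x)"
    proof (rule ccontr)
      assume "\<not> ?thesis"
      then have less: "2 * r\<^sup>2 * card I * card (hits x) \<le> card U - 1" if "x \<in> I \<times> P" for x
        using that by force
      have "card U * n\<^sup>2 = (\<Sum>(e, A, B)\<in>U. n\<^sup>2)" by (simp add: case_prod_beta)
      also have "\<dots> \<le> (\<Sum>(e, A, B)\<in>U. 2 * r\<^sup>2 * card (P \<inter> A \<times> B))"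
        using many by (intro sum_mono) auto
      also have "\<dots> = 2 * r\<^sup>2 * (\<Sum>x\<in>I \<times> P. card (hits x))"
        unfolding count by (simp add: sum_distrib_left case_prod_beta)
      finally have "card I * (card U * n\<^sup>2) \<le> card I * (2 * r\<^sup>2 * (\<Sum>x\<in>I \<times> P. card (hits x)))"
        by (rule mult_left_mono) simp
      also have "\<dots> = (\<Sum>x\<in>I \<times> P. 2 * r\<^sup>2 * card I * card (hits x))"
        by (simp add: sum_distrib_left mult_ac)
      also have "\<dots> \<le> card (I \<times> P) * (card U - 1)"
        using sum_bounded_above[of "I \<times> P", OF less] by simp
      also have "\<dots> \<le> card I * n\<^sup>2 * (card U - 1)"
      proof (rule mult_right_mono)
        have "card P \<le> card ({..<n} \<times> {..<n})" by (rule card_mono) (auto simp: P_def)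
        then show "card (I \<times> P) \<le> card I * n\<^sup>2"
          by (simp add: card_cartesian_product power2_eq_square)
      qed simp
      finally have "(card I * n\<^sup>2) * card U \<le> (card I * n\<^sup>2) * (card U - 1)"
        by (simp add: mult_ac)
      moreover have "card I > 0" using False assms(1) by (auto simp: card_gt_0_iff U_def unhit_def)
      ultimately have "card U \<le> card U - 1" using n(1) by simp
      moreover have "card U > 0" using False finU by (simp add: card_gt_0_iff)
      ultimately show False by linarith
    qed
    then obtain e u v where x: "e \<in> I" "(u, v) \<in> P"
      and hit: "card U \<le> 2 * r\<^sup>2 * card I * card (hits (e, u, v))" by auto
    let ?F = "insert (e, u, v) F"
    show ?thesis
    proof (rule that[of ?F])
      show "?F \<subseteq> I \<times> {..<n} \<times> {..<n}" using assms(2) x by (auto simp: P_def)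
      show "sparse M g ?F" using x by (intro sparse_insert fin assms(3)) (simp add: P_def)
      show "card ?F \<le> Suc (card F)" by (rule card_insert_le_m1) auto
      show "card (incident ?F w) \<le> D" for w
      proof (cases "w = u \<or> w = v")
        case True
        then have "card (incident F w) < D"
          using deg[of w] x by (auto simp: P_def S_def order_le_less)
        moreover have "incident ?F w = insert (e, u, v) (incident F w)"
          using True by (auto simp: incident_def)
        ultimately show ?thesis using D(1) by (simp add: card_insert_le_m1)
      next
        case False
        then have "incident ?F w = incident F w" by (auto simp: incident_def)
        then show ?thesis using deg by simp
      qed
      have "unhit I r n ?F = U - hits (e, u, v)"
        by (auto simp: U_def unhit_def hits_def)
      then have "card (unhit I r n ?F) = card U - card (hits (e, u, v))"
        using card_Diff_subset[OF finh(1), of "(e, u, v)" U] by (auto simp: hits_def)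
      then show "2 * r\<^sup>2 * card I * card (unhit I r n ?F) \<le> (2 * r\<^sup>2 * card I - 1) * card (unhit I r n F)"
        using hit by (simp add: U_def diff_mult_distrib2 diff_mult_distrib)
    qed
  qed
qed

text \<open>The greedy step is iterated \<open>c * n\<close> times. Each step multiplies the number
  of unhit triples by at most \<open>(q - 1) / q\<close>, and \<open>c\<close> steps divide it by at
  least 8, so fewer than one of the initial \<open>k * 4 ^ n\<close> is left.\<close>

lemma sparse_hitting_set:
  fixes M :: "'m::ab_group_add itself" and I :: "'e set"
  assumes "finite I" "r > 0"
  shows "\<exists>n F. F \<subseteq> I \<times> {..<n} \<times> {..<n} \<and> sparse M g F \<and> unhit I r n F = {}"
proof (cases "I = {}")
  case True
  then show ?thesis
    by (intro exI[of _ "{}"] exI[of _ "0 :: nat"]) (simp add: sparse_def unhit_def)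
next
  case False
  define k q where "k = card I" and "q = 2 * r\<^sup>2 * k"
  have k: "k > 0" using False assms(1) by (simp add: k_def card_gt_0_iff)
  then have "r\<^sup>2 * k > 0" using assms(2) by simp
  then have q: "q \<ge> 2" by (simp add: q_def)
  obtain c where c: "8 * (q - 1) ^ c \<le> q ^ c"
  proof -
    have "1 - 1 / real q < 1" using q by simp
    then obtain c where "(1 - 1 / real q) ^ c < 1 / 8"
      using real_arch_pow_inv[of "1/8" "1 - 1 / real q"] by auto
    moreover have "1 - 1 / real q = real (q - 1) / real q" using q by (simp add: field_simps of_nat_diff)
    ultimately have "real (8 * (q - 1) ^ c) < real (q ^ c)"
      using q by (simp add: power_divide field_simps)
    then show thesis using that[of c] by linarith
  qed
  have "c > 0" using c by (cases c) auto
  \<comment> \<open>With this \<open>D\<close> the greedy step applies as long as \<open>F\<close>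
    has at most \<open>c * n\<close> arcs. It does not involve \<open>n\<close>, which can therefore
    be chosen last.\<close>
  define D where "D = 16 * r\<^sup>2 * c"
  \<comment> \<open>The summand \<open>k\<close> is for the final contradiction with
    \<open>n < 2 ^ n\<close>, the other one for the greedy step.\<close>
  define n where "n = k + 4 * r\<^sup>2 * (\<Sum>i\<le>2 * g. D ^ i)"
  have D: "D > 0" using \<open>c > 0\<close> assms(2) by (simp add: D_def)
  have n: "n > 0" "4 * r\<^sup>2 * (\<Sum>i\<le>2 * g. D ^ i) \<le> n" "k \<le> n" using k by (simp_all add: n_def)
  have "\<exists>F \<subseteq> I \<times> {..<n} \<times> {..<n}. sparse M g F \<and> (\<forall>u. card (incident F u) \<le> D) \<and>
      card F \<le> i \<and> q ^ i * card (unhit I r n F) \<le> (q - 1) ^ i * (k * 4 ^ n)" if "i \<le> c * n" for i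
    using that
  proof (induction i)
    case 0
    have "card (unhit I r n {}) \<le> card (I \<times> Pow {..<n} \<times> Pow {..<n})"
      using assms(1) by (intro card_mono) (auto simp: unhit_def)
    also have "\<dots> = k * 4 ^ n"
      by (simp add: card_cartesian_product card_Pow k_def flip: power_mult_distrib)
    finally have "card (unhit I r n {}) \<le> k * 4 ^ n" .
    moreover have "incident ({} :: ('e \<times> nat \<times> nat) set) u = {}" for u by (auto simp: incident_def)
    ultimately show ?case by (intro exI[of _ "{}"]) (simp add: sparse_def)
  next
    case (Suc i)
    then obtain F where F: "F \<subseteq> I \<times> {..<n} \<times> {..<n}" "sparse M g F" "\<And>u. card (incident F u) \<le> D"
      "card F \<le> i" "q ^ i * card (unhit I r n F) \<le> (q - 1) ^ i * (k * 4 ^ n)" by auto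
    have "16 * r\<^sup>2 * card F \<le> 16 * r\<^sup>2 * (c * n)"
      using F(4) Suc.prems by (intro mult_left_mono) auto
    then have "16 * r\<^sup>2 * card F \<le> D * n" by (simp add: D_def mult_ac)
    from greedy_step[OF assms(1) F(1-3) D this n(1,2)]
    obtain F' where F': "F' \<subseteq> I \<times> {..<n} \<times> {..<n}" "sparse M g F'"
      "\<And>u. card (incident F' u) \<le> D" "card F' \<le> Suc (card F)"
      "q * card (unhit I r n F') \<le> (q - 1) * card (unhit I r n F)"
      unfolding q_def k_def by metis
    have "q ^ Suc i * card (unhit I r n F') = q ^ i * (q * card (unhit I r n F'))" by simp
    also have "\<dots> \<le> q ^ i * ((q - 1) * card (unhit I r n F))"
      using F'(5) by (rule mult_left_mono) simp
    also have "\<dots> = (q - 1) * (q ^ i * card (unhit I r n F))" by simp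
    also have "\<dots> \<le> (q - 1) * ((q - 1) ^ i * (k * 4 ^ n))"
      using F(5) by (rule mult_left_mono) simp
    finally show ?case using F' F(4) by (intro exI[of _ F']) auto
  qed
  from this[of "c * n"] obtain F where F: "F \<subseteq> I \<times> {..<n} \<times> {..<n}" "sparse M g F"
    "q ^ (c * n) * card (unhit I r n F) \<le> (q - 1) ^ (c * n) * (k * 4 ^ n)" by auto
  have "unhit I r n F = {}"
  proof (rule ccontr)
    assume "unhit I r n F \<noteq> {}"
    moreover have "finite (unhit I r n F)"
      by (rule finite_subset[of _ "I \<times> Pow {..<n} \<times> Pow {..<n}"])
        (use assms(1) in \<open>auto simp: unhit_def\<close>)
    ultimately have "1 \<le> card (unhit I r n F)" by (simp add: Suc_leI card_gt_0_iff)
    then have "q ^ (c * n) * 1 \<le> q ^ (c * n) * card (unhit I r n F)" by (rule mult_left_mono) simp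
    also note F(3)
    finally have "8 ^ n * q ^ (c * n) \<le> 8 ^ n * ((q - 1) ^ (c * n) * (k * 4 ^ n))" by simp
    also have "\<dots> = (8 * (q - 1) ^ c) ^ n * (k * 4 ^ n)"
      by (simp add: power_mult_distrib power_mult)
    also have "\<dots> \<le> (q ^ c) ^ n * (k * 4 ^ n)" using c by (intro mult_right_mono power_mono) auto
    finally have "q ^ (c * n) * 8 ^ n \<le> q ^ (c * n) * (k * 4 ^ n)"
      by (simp add: power_mult mult.commute)
    then have "8 ^ n \<le> k * 4 ^ n" using q by simp
    moreover have "(8::nat) ^ n = 2 ^ n * 4 ^ n" by (simp flip: power_mult_distrib)
    ultimately have "2 ^ n \<le> k" by simp
    with n(3) less_exp[of n] show False by linarith
  qed
  with F(1,2) show ?thesis by blast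
qed

section \<open>Blow-ups of large girth\<close>

text \<open>The action of the integers on an abelian group. At most one of the two sums is nonempty,
  as \<open>nat\<close> sends negative integers to 0.\<close>

definition zmul :: "int \<Rightarrow> 'a::ab_group_add \<Rightarrow> 'a" where
  "zmul k x = (\<Sum>_<nat k. x) - (\<Sum>_<nat (- k). x)"

lemma zmul_0 [simp]: "zmul 0 x = 0" and zmul_1 [simp]: "zmul 1 x = x"
  by (simp_all add: zmul_def)

lemma zmul_plus1: "zmul (k + 1) x = zmul k x + x"
proof (cases "k \<ge> 0")
  case True
  then show ?thesis by (simp add: zmul_def nat_add_distrib)
next
  case False
  then have "nat (- k) = Suc (nat (- (k + 1)))" by simp
  with False show ?thesis by (simp add: zmul_def)
qed

lemma zmul_add: "zmul (j + k) x = zmul j x + zmul k x"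
proof (induction k rule: int_induct[of _ 0])
  case (step1 i)
  then show ?case using zmul_plus1[of "j + i" x] by (simp add: zmul_plus1 add.assoc)
next
  case (step2 i)
  then show ?case
    using zmul_plus1[of "j + (i - 1)" x] zmul_plus1[of "i - 1" x] by (simp add: algebra_simps)
qed simp

lemma zmul_diff: "zmul (j - k) x = zmul j x - zmul k x"
  using zmul_add[of "j - k" k x] by (simp add: algebra_simps)

lemma zmul_minus: "zmul (- k) x = - zmul k x"
  using zmul_diff[of 0 k x] by simp

text \<open>The image of a walk under \<open>f\<close> as an integer vector, which no longer refers
  to a tension or to the group.\<close>

definition multiplicity_vector :: "('a \<Rightarrow> 'e) \<Rightarrow> ('a \<times> bool) list \<Rightarrow> 'e \<Rightarrow> int" where
  "multiplicity_vector f p = (\<lambda>e. wsum (\<lambda>a. of_bool (f a = e)) p)"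

text \<open>Collecting the terms by image arc turns the sum of a pulled-back tension into a pairing
  of the tension with an integer vector.\<close>

lemma wsum_eq_multiplicity_vector:
  assumes "finite E" "f ` fst ` set p \<subseteq> E"
  shows "wsum (t \<circ> f) p = (\<Sum>e\<in>E. zmul (multiplicity_vector f p e) (t e))"
  using assms(2)
proof (induction p)
  case (Cons x p)
  obtain a d where x: "x = (a, d)" by fastforce
  have "(\<Sum>e\<in>E. zmul (of_bool (f a = e)) (t e)) = (\<Sum>e\<in>E. if f a = e then t e else 0)"
    by (rule sum.cong) auto
  also have "\<dots> = t (f a)" using assms(1) Cons.prems x by simp
  finally have single: "(\<Sum>e\<in>E. zmul (of_bool (f a = e)) (t e)) = t (f a)" .
  have "multiplicity_vector f (x # p) e =
      (if d then of_bool (f a = e) else - of_bool (f a = e)) + multiplicity_vector f p e" for e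
    by (simp add: x multiplicity_vector_def)
  then show ?case
    using Cons single by (auto simp: x zmul_add zmul_minus sum.distrib sum_negf)
qed (simp add: multiplicity_vector_def)

lemma multiplicity_vector_eq_0:
  "e \<notin> f ` fst ` set p \<Longrightarrow> multiplicity_vector f p e = 0"
  by (induction p) (auto simp: multiplicity_vector_def)

lemma abs_multiplicity_vector: "\<bar>multiplicity_vector f p e\<bar> \<le> int (length p)"
  by (induction p) (auto simp: multiplicity_vector_def)

text \<open>Pigeonhole. It supplies sets of the density that \<open>unhit\<close> asks for.\<close>

lemma large_colour_class:
  assumes "finite A" "finite C" "C \<noteq> {}" "c ` A \<subseteq> C"
  shows "\<exists>k\<in>C. card A \<le> card C * card {a\<in>A. c a = k}"
proof (rule ccontr)
  assume "\<not> ?thesis"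
  then have less: "card C * card {a\<in>A. c a = k} < card A" if "k \<in> C" for k
    using that by force
  have "A = (\<Union>k\<in>C. {a\<in>A. c a = k})" using assms(4) by auto
  then have "card A \<le> (\<Sum>k\<in>C. card {a\<in>A. c a = k})" using card_UN_le[OF assms(2)] by metis
  then have "card C * card A \<le> (\<Sum>k\<in>C. card C * card {a\<in>A. c a = k})"
    by (metis mult_le_mono2 sum_distrib_left)
  also have "\<dots> < (\<Sum>k\<in>C. card A)" using assms less by (intro sum_strict_mono) auto
  finally show False by simp
qed

section \<open>Blow-ups, and carrying maps from a blow-up back to the original graph\<close>

definition blowup ::
  "('w, 'f) pre_digraph \<Rightarrow> nat \<Rightarrow> ('f \<times> nat \<times> nat) set \<Rightarrow> ('w \<times> nat, 'f \<times> nat \<times> nat) pre_digraph"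
  where "blowup H n F = \<lparr>verts = verts H \<times> {..<n}, arcs = F,
    tail = (\<lambda>(e, u, v). (tail H e, u)), head = (\<lambda>(e, u, v). (head H e, v))\<rparr>"

lemma blowup_simps [simp]:
  "verts (blowup H n F) = verts H \<times> {..<n}"
  "arcs (blowup H n F) = F"
  "tail (blowup H n F) (e, u, v) = (tail H e, u)"
  "head (blowup H n F) (e, u, v) = (head H e, v)"
  by (simp_all add: blowup_def)

lemma fin_digraph_blowup:
  assumes "fin_digraph H" "F \<subseteq> arcs H \<times> {..<n} \<times> {..<n}"
  shows "fin_digraph (blowup H n F)"
proof -
  interpret fin_digraph H by fact
  have "finite F" by (rule finite_subset[OF assms(2)]) simp
  then show ?thesis using assms(2) by unfold_locales auto
qed

lemma hom_le_blowup:
  assumes "F \<subseteq> arcs H \<times> {..<n} \<times> {..<n}"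
  shows "hom_le (blowup H n F) H"
  by (rule hom_leI[of _ fst _ fst]) (use assms in auto)

text \<open>
  The image of a circuit of \<open>H\<close> under the map \<open>g\<close> constructed here lies in
  \<open>L + N \<int>\<^bsup>arcs G\<^esup>\<close> and has entries bounded by \<open>card (arcs H)\<close>, so by the choice of \<open>N\<close> it
  lies in \<open>L\<close>.
\<close>

lemma tension_le_of_blowup:
  fixes G :: "('v, 'e) pre_digraph" and H :: "('w, 'f) pre_digraph"
    and M :: "'m::ab_group_add itself"
  assumes "fin_digraph G" "fin_digraph H"
  shows "\<exists>r>0. \<forall>n F. F \<subseteq> arcs H \<times> {..<n} \<times> {..<n} \<longrightarrow> unhit (arcs H) r n F = {} \<longrightarrow>
    tension_le M (blowup H n F) G \<longrightarrow> tension_le M H G"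
proof -
  interpret G: fin_digraph G by fact
  interpret H: fin_digraph H by fact
  define E where "E = arcs G"
  have E: "finite E" by (simp add: E_def)
  \<comment> \<open>Integer vectors that agree modulo \<open>L\<close> cannot be told apart by the
    tensions of \<open>G\<close>.\<close>
  define L where "L = {z. (\<forall>e. e \<notin> E \<longrightarrow> z e = 0) \<and>
    (\<forall>t :: 'e \<Rightarrow> 'm. tension G t \<longrightarrow> (\<Sum>e\<in>E. zmul (z e) (t e)) = 0)}"
  have L0: "(\<lambda>_. 0) \<in> L" by (simp add: L_def)
  have Ldiff: "(\<lambda>e. x e - y e) \<in> L" if "x \<in> L" "y \<in> L" for x y
    using that by (simp add: L_def zmul_diff sum_subtractf)
  have Ladd: "(\<lambda>e. x e + y e) \<in> L" if "x \<in> L" "y \<in> L" for x y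
    using that by (simp add: L_def zmul_add sum.distrib)
  have Lsupp: "x e = 0" if "x \<in> L" "e \<notin> E" for x e using that by (simp add: L_def)
  \<comment> \<open>The bound \<open>card (arcs H)\<close> suffices because a circuit of
    \<open>H\<close> uses each arc at most once.\<close>
  have "\<exists>N::int>0. \<forall>z l w. (\<forall>e. \<bar>z e\<bar> \<le> int (card (arcs H))) \<longrightarrow> (\<forall>e. e \<notin> E \<longrightarrow> z e = 0) \<longrightarrow>
      l \<in> L \<longrightarrow> z = (\<lambda>e. l e + N * w e) \<longrightarrow> z \<in> L"
    using E L0 Ldiff Lsupp by (rule separating_modulus_box)
  then obtain N :: int where N: "N > 0"
    and NL: "\<And>z l w. (\<And>e. \<bar>z e\<bar> \<le> int (card (arcs H))) \<Longrightarrow> (\<And>e. e \<notin> E \<Longrightarrow> z e = 0) \<Longrightarrow>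
      l \<in> L \<Longrightarrow> z = (\<lambda>e. l e + N * w e) \<Longrightarrow> z \<in> L"
    by blast
  \<comment> \<open>The colours: residue vectors modulo \<open>N\<close>. Their number does not
    depend on the blow-up and is the required \<open>r\<close>.\<close>
  define C where "C = {c :: 'e \<Rightarrow> int. \<forall>e. (e \<in> E \<longrightarrow> c e \<in> {0..<N}) \<and> (e \<notin> E \<longrightarrow> c e = 0)}"
  have "finite C"
    unfolding C_def using E finite_atLeastLessThan_int by (rule finite_set_of_finite_funs)
  moreover have "(\<lambda>_. 0) \<in> C" using N by (simp add: C_def)
  ultimately have C: "finite C" "C \<noteq> {}" by auto
  have "tension_le M H G"
    if F: "F \<subseteq> arcs H \<times> {..<n} \<times> {..<n}"
      and hit: "unhit (arcs H) (card C) n F = {}"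
      and le: "tension_le M (blowup H n F) G" for n F
  proof -
    let ?B = "blowup H n F"
    interpret B: fin_digraph ?B using assms(2) F by (rule fin_digraph_blowup)
    obtain f where f: "f \<in> F \<rightarrow> E" "\<And>t :: 'e \<Rightarrow> 'm. tension G t \<Longrightarrow> tension ?B (t \<circ> f)"
      using le unfolding tension_le_def tension_continuous_def E_def by auto
    have "\<exists>W. (\<forall>v. set (W v) \<subseteq> F \<times> UNIV) \<and> (\<forall>(t :: 'f \<times> nat \<times> nat \<Rightarrow> 'm) a. tension ?B t \<longrightarrow>
        a \<in> F \<longrightarrow> t a = wsum t (W (head ?B a)) - wsum t (W (tail ?B a)))"
      using universal_potential[OF B.wf_digraph, where 'm = 'm] by simp
    then obtain W where WF: "\<And>v. set (W v) \<subseteq> F \<times> UNIV"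
      and W: "\<And>(t :: 'f \<times> nat \<times> nat \<Rightarrow> 'm) a. tension ?B t \<Longrightarrow> a \<in> F \<Longrightarrow>
        t a = wsum t (W (head ?B a)) - wsum t (W (tail ?B a))" by metis
    \<comment> \<open>A potential of \<open>f\<close> with integer vectors as values, the same for
      all tensions.\<close>
    define p where "p v = multiplicity_vector f (W v)" for v
    have WE: "f ` fst ` set (W v) \<subseteq> E" for v using WF[of v] f(1) by force
    have p0: "p v e = 0" if "e \<notin> E" for v e
      unfolding p_def using WE[of v] that by (intro multiplicity_vector_eq_0) auto
    \<comment> \<open>The error by which \<open>f\<close> fails to be the difference of
      \<open>p\<close>. Tensions annihilate it, because the walks \<open>W\<close> compute every
      pulled-back tension.\<close>
    define l where "l a = (\<lambda>e. of_bool (f a = e) - (p (head ?B a) e - p (tail ?B a) e))" for a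
    have l: "l a \<in> L" if a: "a \<in> F" for a
      unfolding L_def
    proof (intro CollectI conjI allI impI)
      show "l a e = 0" if "e \<notin> E" for e using that a f(1) by (auto simp: l_def p0)
      fix t :: "'e \<Rightarrow> 'm" assume t: "tension G t"
      have "wsum (t \<circ> f) (W v) = (\<Sum>e\<in>E. zmul (p v e) (t e))" for v
        unfolding p_def using E WE by (rule wsum_eq_multiplicity_vector)
      moreover have "t (f a) = (\<Sum>e\<in>E. zmul (of_bool (f a = e)) (t e))"
        using wsum_eq_multiplicity_vector[OF E, of f "[(a, True)]" t] a f(1)
        by (auto simp: multiplicity_vector_def)
      ultimately show "(\<Sum>e\<in>E. zmul (l a e) (t e)) = 0"
        using W[OF f(2)[OF t] a] by (simp add: l_def zmul_diff sum_subtractf)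
    qed
    define c where "c v = (\<lambda>e. p v e mod N)" for v
    have c: "c v \<in> C" for v using N by (auto simp: C_def c_def p0)
    have "\<exists>k. n \<le> card C * card {u\<in>{..<n}. c (x, u) = k}" for x
      using large_colour_class[OF finite_lessThan C, of "\<lambda>u. c (x, u)" n] c by auto
    \<comment> \<open>A frequent colour among the copies of each vertex \<open>x\<close>.\<close>
    then obtain k where k: "\<And>x. n \<le> card C * card {u\<in>{..<n}. c (x, u) = k x}" by metis
    have "\<exists>x\<in>F. fst x = e \<and> c (tail ?B x) = k (tail H e) \<and> c (head ?B x) = k (head H e)"
      if e: "e \<in> arcs H" for e
    proof -
      let ?A = "\<lambda>x. {u\<in>{..<n}. c (x, u) = k x}"
      have "(e, ?A (tail H e), ?A (head H e)) \<notin> unhit (arcs H) (card C) n F" using hit by simp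
      then obtain a b where "(e, a, b) \<in> F" "a \<in> ?A (tail H e)" "b \<in> ?A (head H e)"
        using e k[of "tail H e"] k[of "head H e"] by (auto simp: unhit_def)
      then show ?thesis by (intro bexI[of _ "(e, a, b)"]) auto
    qed
    \<comment> \<open>Each arc of \<open>H\<close> lifts to an arc between the frequent colour
      classes over its ends, as otherwise these classes would be unhit.\<close>
    then obtain \<alpha> where \<alpha>: "\<And>e. e \<in> arcs H \<Longrightarrow> \<alpha> e \<in> F \<and> fst (\<alpha> e) = e \<and>
        c (tail ?B (\<alpha> e)) = k (tail H e) \<and> c (head ?B (\<alpha> e)) = k (head H e)"
      by metis
    define g where "g = f \<circ> \<alpha>"
    define w where "w e e' = p (head ?B (\<alpha> e)) e' div N - p (tail ?B (\<alpha> e)) e' div N" for e e'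
    \<comment> \<open>The values of \<open>p\<close> are split into residue and quotient modulo
      \<open>N\<close>. The residues at the ends of \<open>\<alpha> e\<close> depend only on the
      ends of \<open>e\<close>, so they telescope around a circuit of \<open>H\<close>.\<close>
    have dec: "of_bool (g e = e') = l (\<alpha> e) e' + N * w e e' + (k (head H e) e' - k (tail H e) e')"
      if "e \<in> arcs H" for e e'
    proof -
      have "p v e' = c v e' + N * (p v e' div N)" for v by (simp add: c_def)
      from this[of "head ?B (\<alpha> e)"] this[of "tail ?B (\<alpha> e)"] \<alpha>[OF that] show ?thesis
        by (simp add: g_def l_def w_def right_diff_distrib)
    qed
    have "tension H (t \<circ> g)" if t: "tension G t" for t :: "'e \<Rightarrow> 'm"
      unfolding tension_def
    proof (intro allI impI)
      fix P assume P: "circuit H P"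
      then obtain u where u: "bcas H u P u" "set P \<subseteq> arcs H \<times> UNIV"
        by (auto simp: circuit_def pre_digraph.cycle_def pre_digraph.awalk_def)
      have dist: "distinct (map fst P)" using P by (simp add: circuit_def)
      have gP: "g ` fst ` set P \<subseteq> E" using u(2) \<alpha> f(1) unfolding g_def by fastforce
      have "length P = card (set (map fst P))" using distinct_card[OF dist] by simp
      also have "\<dots> \<le> card (arcs H)" using u(2) by (intro card_mono) auto
      finally have len: "length P \<le> card (arcs H)" .
      have split: "wsum (\<lambda>e. of_bool (g e = e')) Q = wsum (\<lambda>e. l (\<alpha> e) e') Q + N * wsum (\<lambda>e. w e e') Q
          + wsum (\<lambda>e. k (head H e) e' - k (tail H e) e') Q" if "set Q \<subseteq> arcs H \<times> UNIV" for Q e'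
        using that by (induction Q) (auto simp: dec algebra_simps)
      have lL: "(\<lambda>e'. wsum (\<lambda>e. l (\<alpha> e) e') Q) \<in> L" if "set Q \<subseteq> arcs H \<times> UNIV" for Q
        using that
      proof (induction Q)
        case (Cons x Q)
        obtain e d where x: "x = (e, d)" by fastforce
        have "l (\<alpha> e) \<in> L" using Cons.prems x \<alpha> l by auto
        with Cons Ladd[of "l (\<alpha> e)"] Ldiff[of _ "l (\<alpha> e)"] show ?case by (cases d) (auto simp: x)
      qed (simp add: L0)
      have "multiplicity_vector g P \<in> L"
      proof (rule NL)
        show "\<bar>multiplicity_vector g P e\<bar> \<le> int (card (arcs H))" for e
          using abs_multiplicity_vector[of g P e] len by linarith
        show "multiplicity_vector g P e = 0" if "e \<notin> E" for e
          using gP that by (intro multiplicity_vector_eq_0) auto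
        show "multiplicity_vector g P =
            (\<lambda>e'. wsum (\<lambda>e. l (\<alpha> e) e') P + N * wsum (\<lambda>e. w e e') P)"
          using split[OF u(2)] wsum_potential[OF u(1), of "\<lambda>v. k v e'" for e']
          by (simp add: multiplicity_vector_def)
      qed (rule lL[OF u(2)])
      then have "wsum (t \<circ> g) P = 0"
        using wsum_eq_multiplicity_vector[OF E gP, of t] t by (simp add: L_def)
      then show "sum (t \<circ> g) (circuit_plus P) = sum (t \<circ> g) (circuit_minus P)"
        using wsum_eq_circuit_sums[OF dist, of "t \<circ> g"] by simp
    qed
    moreover have "g \<in> arcs H \<rightarrow> arcs G" using \<alpha> f(1) by (auto simp: g_def E_def)
    ultimately show ?thesis unfolding tension_le_def tension_continuous_def by blast
  qed
  moreover have "card C > 0" using C by (simp add: card_gt_0_iff)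
  ultimately show ?thesis by blast
qed

section \<open>Disjoint unions, and removing the blow-up from a union\<close>

definition disj_union ::
  "('v, 'e) pre_digraph \<Rightarrow> ('w, 'f) pre_digraph \<Rightarrow> ('v + 'w, 'e + 'f) pre_digraph" where
  "disj_union G H = \<lparr>verts = verts G <+> verts H, arcs = arcs G <+> arcs H,
     tail = map_sum (tail G) (tail H), head = map_sum (head G) (head H)\<rparr>"

lemma disj_union_simps [simp]:
  "verts (disj_union G H) = verts G <+> verts H"
  "arcs (disj_union G H) = arcs G <+> arcs H"
  "tail (disj_union G H) = map_sum (tail G) (tail H)"
  "head (disj_union G H) = map_sum (head G) (head H)"
  by (simp_all add: disj_union_def)

lemma fin_digraph_disj_union:
  assumes "fin_digraph G" "fin_digraph H"
  shows "fin_digraph (disj_union G H)"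
proof -
  interpret G: fin_digraph G by fact
  interpret H: fin_digraph H by fact
  show ?thesis by unfold_locales auto
qed

lemma hom_le_disj_union1: "hom_le G (disj_union G H)"
  by (rule hom_leI[of _ Inl _ Inl]) auto

lemma hom_le_disj_union2: "hom_le H (disj_union G H)"
  by (rule hom_leI[of _ Inr _ Inr]) auto

lemma disj_union_hom_le:
  assumes "hom_le G K" "hom_le H K"
  shows "hom_le (disj_union G H) K"
proof -
  obtain f g where "digraph_hom G K f" "digraph_hom H K g"
    using assms unfolding hom_le_def by blast
  then have "digraph_hom (disj_union G H) K (case_sum f g)"
    unfolding digraph_hom_def arcs_ends_conv by (force simp: image_iff)
  then show ?thesis unfolding hom_le_def by blast
qed

lemma disj_union_tension_le:
  fixes G :: "('v, 'e) pre_digraph" and H :: "('w, 'f) pre_digraph"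
    and K :: "('x, 'y) pre_digraph" and M :: "'m::ab_group_add itself"
  assumes "wf_digraph G" "wf_digraph H" "wf_digraph K" "tension_le M G K" "tension_le M H K"
  shows "tension_le M (disj_union G H) K"
proof -
  interpret G: wf_digraph G by fact
  interpret H: wf_digraph H by fact
  have wf: "wf_digraph (disj_union G H)" by unfold_locales auto
  obtain f g where fg: "tension_continuous M G K f" "tension_continuous M H K g"
    using assms unfolding tension_le_def by blast
  have "tension (disj_union G H) (t \<circ> case_sum f g)" if "tension K t" for t :: "'y \<Rightarrow> 'm"
  proof -
    have "tension G (t \<circ> f)" "tension H (t \<circ> g)"
      using fg that by (simp_all add: tension_continuous_def)
    then obtain q1 q2 where "\<forall>a\<in>arcs G. (t \<circ> f) a = q1 (head G a) - q1 (tail G a)"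
      "\<forall>a\<in>arcs H. (t \<circ> g) a = q2 (head H a) - q2 (tail H a)"
      by (elim tension_potentialE[OF assms(1)] tension_potentialE[OF assms(2)])
    then show ?thesis unfolding tension_iff_potential[OF wf]
      by (intro exI[of _ "case_sum q1 q2"]) auto
  qed
  moreover have "case_sum f g \<in> arcs (disj_union G H) \<rightarrow> arcs K"
    using fg by (auto simp: tension_continuous_def)
  ultimately show ?thesis unfolding tension_le_def tension_continuous_def by blast
qed

text \<open>The image of \<open>H\<close> uses so few arcs of the blow-up that, by sparsity, giving
  them all the value \<open>t a\<close> is a potential difference. They can thus all be redirected
  to the arc \<open>a\<close>. The target \<open>G'\<close> is kept apart from \<open>G\<close> to
  cover a \<open>G\<close> without arcs.\<close>

lemma tension_le_cancel_blowup:
  fixes G :: "('v, 'e) pre_digraph" and H :: "('w, 'f) pre_digraph"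
    and G' :: "('x, 'y) pre_digraph" and M :: "'m::ab_group_add itself"
  assumes "fin_digraph G" "fin_digraph H" "F \<subseteq> arcs H \<times> {..<n} \<times> {..<n}"
    and sparse: "sparse M (card (arcs H)) F"
    and "tension_le M H (disj_union G (blowup H n F))"
    and "tension_le M G G'" "a \<in> arcs G'"
  shows "tension_le M H G'"
proof -
  interpret G: fin_digraph G by fact
  interpret H: fin_digraph H by fact
  let ?K = "disj_union G (blowup H n F)"
  interpret K: fin_digraph ?K
    by (intro fin_digraph_disj_union fin_digraph_blowup assms(1-3))
  obtain f where f: "f \<in> arcs H \<rightarrow> arcs G <+> F" "\<And>t :: 'e + 'f \<times> nat \<times> nat \<Rightarrow> 'm. tension ?K t \<Longrightarrow> tension H (t \<circ> f)"
    using assms(5) unfolding tension_le_def tension_continuous_def by auto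
  obtain j where j: "j \<in> arcs G \<rightarrow> arcs G'" "\<And>t :: 'y \<Rightarrow> 'm. tension G' t \<Longrightarrow> tension G (t \<circ> j)"
    using assms(6) unfolding tension_le_def tension_continuous_def by auto
  define g where "g = case_sum j (\<lambda>_. a) \<circ> f"
  define T where "T = {x \<in> F. Inr x \<in> f ` arcs H}"
  have "T \<subseteq> projr ` f ` arcs H"
  proof
    fix x assume "x \<in> T"
    then obtain b where "b \<in> arcs H" "f b = Inr x" by (auto simp: T_def)
    then show "x \<in> projr ` f ` arcs H" by (metis image_eqI sum.sel(2))
  qed
  then have "card T \<le> card (f ` arcs H)" by (intro surj_card_le) auto
  also have "\<dots> \<le> card (arcs H)" by (intro card_image_le) simp
  finally have T: "T \<subseteq> F" "card T \<le> card (arcs H)" by (auto simp: T_def)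
  have "tension H (t \<circ> g)" if t: "tension G' t" for t :: "'y \<Rightarrow> 'm"
  proof -
    obtain q1 where q1: "\<forall>b\<in>arcs G. (t \<circ> j) b = q1 (head G b) - q1 (tail G b)"
      using G.wf_digraph j(2)[OF t] by (rule tension_potentialE)
    obtain q2 where q2: "\<forall>(e, u, v)\<in>T. t a = q2 v - q2 u"
      using sparse[unfolded sparse_def, rule_format, OF T, of "\<lambda>_. t a"] by blast
    \<comment> \<open>A tension on the whole union whose values on the image of \<open>f\<close> are
      those of \<open>t\<close> after the redirection.\<close>
    define s where "s = case_sum (t \<circ> j) (\<lambda>(e :: 'f, u, v). q2 v - q2 u)"
    have "tension ?K s" unfolding tension_iff_potential[OF K.wf_digraph]
      using q1 by (intro exI[of _ "case_sum q1 (q2 \<circ> snd)"]) (auto simp: s_def)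
    then have "tension H (s \<circ> f)" by (rule f(2))
    moreover have "(s \<circ> f) b = (t \<circ> g) b" if b: "b \<in> arcs H" for b
    proof (cases "f b")
      case (Inl x)
      then show ?thesis by (simp add: s_def g_def)
    next
      case (Inr x)
      then have "x \<in> T" using f(1) b by (force simp: T_def)
      then show ?thesis using q2 Inr by (auto simp: s_def g_def)
    qed
    ultimately show ?thesis using tension_cong[OF H.wf_digraph, of "s \<circ> f" "t \<circ> g"] by blast
  qed
  moreover have "g b \<in> arcs G'" if "b \<in> arcs H" for b
    using f(1) j(1) assms(7) that by (cases "f b") (auto simp: g_def Pi_iff)
  ultimately have "tension_continuous M H G' g" by (simp add: tension_continuous_def)
  then show ?thesis unfolding tension_le_def by blast
qed

section \<open>The intermediate graph\<close>

theorem corollary3: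
  fixes G :: "('v, 'e) pre_digraph" and H :: "('w, 'f) pre_digraph"
    and M :: "'m::ab_group_add itself"
  assumes "fin_digraph G" and "fin_digraph H"
    and "tension_less M G H"
    and "\<not> tension_le M H K2"
  shows "(\<exists>K :: (nat, nat) pre_digraph. fin_digraph K \<and>
            tension_less M G K \<and> tension_less M K H) \<and>
         (hom_less G H \<longrightarrow>
           (\<exists>K :: (nat, nat) pre_digraph. fin_digraph K \<and>
             tension_less M G K \<and> tension_less M K H \<and>
             hom_less G K \<and> hom_less K H))"
proof -
  interpret G: fin_digraph G by fact
  interpret H: fin_digraph H by fact
  have GH: "tension_le M G H" "\<not> tension_le M H G"
    using assms(3) by (simp_all add: tension_less_def)
  obtain r where "r > 0" and r: "\<And>n F. F \<subseteq> arcs H \<times> {..<n} \<times> {..<n} \<Longrightarrow>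
      unhit (arcs H) r n F = {} \<Longrightarrow> tension_le M (blowup H n F) G \<Longrightarrow> tension_le M H G"
    using tension_le_of_blowup[OF assms(1,2), of M] by blast
  \<comment> \<open>The girth bound \<open>card (arcs H)\<close> keeps \<open>H\<close> from lying
    below the union; hitting with density parameter \<open>r\<close> keeps the blow-up from lying
    below \<open>G\<close>.\<close>
  obtain n F where F: "F \<subseteq> arcs H \<times> {..<n} \<times> {..<n}" "sparse M (card (arcs H)) F"
    "unhit (arcs H) r n F = {}"
    using sparse_hitting_set[OF H.finite_arcs \<open>r > 0\<close>] by blast
  let ?B = "blowup H n F" and ?S = "disj_union G (blowup H n F)"
  interpret B: fin_digraph ?B using assms(2) F(1) by (rule fin_digraph_blowup)
  interpret S: fin_digraph ?S by (intro fin_digraph_disj_union G.fin_digraph B.fin_digraph)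
  obtain K :: "(nat, nat) pre_digraph" where K: "fin_digraph K" "hom_le ?S K" "hom_le K ?S"
    using nat_copy[OF S.fin_digraph] .
  interpret K: fin_digraph K by fact
  note hom = hom_le_imp_tension_le[where M = M]
  have SK: "tension_le M ?S K" "tension_le M K ?S"
    using K(2,3) by (auto intro: hom S.wf_digraph K.wf_digraph)
  have "tension_le M ?B H"
    using hom_le_blowup[OF F(1)] by (intro hom B.wf_digraph H.wf_digraph)
  then have KH: "tension_le M K H"
    using tension_le_trans[OF SK(2)] GH(1)
    by (metis disj_union_tension_le G.wf_digraph B.wf_digraph H.wf_digraph)
  have homGK: "hom_le G K" by (rule hom_le_trans[OF hom_le_disj_union1 K(2)])
  have GK: "tension_le M G K" using homGK by (intro hom G.wf_digraph K.wf_digraph)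
  have notKG: "\<not> tension_le M K G"
  proof
    assume "tension_le M K G"
    moreover have "tension_le M ?B K"
      using hom_le_trans[OF hom_le_disj_union2 K(2)] by (intro hom B.wf_digraph K.wf_digraph)
    ultimately have "tension_le M ?B G" by (rule tension_le_trans[rotated])
    with r[OF F(1,3)] GH(2) show False by blast
  qed
  have notHK: "\<not> tension_le M H K"
  proof
    assume "tension_le M H K"
    then have HS: "tension_le M H ?S" using SK(2) by (rule tension_le_trans)
    show False
    proof (cases "arcs G = {}")
      case True
      \<comment> \<open>There is no arc of \<open>G\<close> to redirect to, but \<open>G\<close>
        lies below \<open>K2\<close> trivially, and the arc of \<open>K2\<close> takes that
        role.\<close>
      have "tension G t" for t :: "'e \<Rightarrow> 'm"
        by (simp add: tension_iff_potential[OF G.wf_digraph] True)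
      then have "tension_continuous M G K2 (\<lambda>_. ())"
        by (simp add: tension_continuous_def K2_def)
      then have "tension_le M G K2" by (auto simp: tension_le_def)
      then have "tension_le M H K2"
        by (rule tension_le_cancel_blowup[OF assms(1,2) F(1,2) HS, where a = "()"]) (simp add: K2_def)
      with assms(4) show False by blast
    next
      case False
      have "tension_continuous M G G id" by (simp add: tension_continuous_def)
      then have "tension_le M G G" by (auto simp: tension_le_def)
      moreover obtain b where "b \<in> arcs G" using False by blast
      ultimately have "tension_le M H G" by (rule tension_le_cancel_blowup[OF assms(1,2) F(1,2) HS])
      with GH(2) show False by blast
    qed
  qed
  have less: "tension_less M G K" "tension_less M K H"
    using GK KH notKG notHK by (simp_all add: tension_less_def)
  have "hom_less G K \<and> hom_less K H" if "hom_less G H"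
  proof -
    have "hom_le K H"
      using that disj_union_hom_le[OF _ hom_le_blowup[OF F(1)]] hom_le_trans[OF K(3)]
      unfolding hom_less_def by blast
    \<comment> \<open>A homomorphism would induce a tension-continuous map, so strictness carries
      over.\<close>
    moreover have "\<not> hom_le K G" using notKG hom[OF K.wf_digraph G.wf_digraph] by blast
    moreover have "\<not> hom_le H K" using notHK hom[OF H.wf_digraph K.wf_digraph] by blast
    ultimately show ?thesis using homGK by (simp add: hom_less_def)
  qed
  with K(1) less show ?thesis by blast
qed

end
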